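(* Let $K$ be a finitely ramified self-similar set with contractions $f_1,\dots,f_m$ and approximating graphs $V_n$, $n\ge0$ (as defined in the context; no symmetry is assumed). Then: (1) if $V_1$ is a tree, then $\tau(V_n)=1$ for all $n\ge0$; (2) if $V_1$ is not a tree, then $\log\tau(V_n)\in\Theta(|V_n|)=\Theta(m^n)$, i.e. $|V_n|$ and $\log\tau(V_n)$ are both bounded above and below by positive constant multiples of $m^n$ for all sufficiently large $n$.
   Context: $K$ is a compact connected metric space, $f_1,\dots,f_m$ are injective contractions of a complete metric space containing $K$ with $K=f_1(K)\cup\dots\cup f_m(K)$, and there is a finite set $F_0\subset K$ with $|F_0|\ge2$ such that $f_j(K)\cap f_k(K)=f_j(F_0)\cap f_k(F_0)$ for $j\neq k$, and if $v\in F_0\cap f_j(K)$ then $v$ is the fixed point of $f_j$. For a word $\omega=\omega_1\cdots\omega_n$ put $f_\omega=f_{\omega_1}\circ\cdots\circ f_{\omega_n}$. $V_0$ is the complete graph on $F_0$; for $n\ge1$, $V_n$ has vertex set $\bigcup_{|\omega|=n}f_\omega(F_0)$ and is the union of the $m^n$ copies $f_\omega(V_0)$, $|\omega|=n$ (edges counted with multiplicity). $|V_n|$ is the number of vertices and $\tau(V_n)$ the number of spanning trees of $V_n$. *)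

theory Defs
  imports "HOL-Analysis.Analysis" "HOL-Library.Landau_Symbols"
begin

section \<open>Undirected multigraphs\<close>

text \<open>Parallel edges are distinct elements of \<open>medges\<close> with the same set of end vertices;
  a loop has a singleton as its set of end vertices.\<close>

record ('v, 'e) multigraph =
  mverts :: "'v set"
  medges :: "'e set"
  mends :: "'e \<Rightarrow> 'v set"

definition mconnected :: "('v, 'e) multigraph \<Rightarrow> bool" where
  "mconnected G \<longleftrightarrow> mverts G \<noteq> {} \<and>
     (\<forall>u\<in>mverts G. \<forall>v\<in>mverts G. (u, v) \<in> {(x, y). \<exists>e\<in>medges G. mends G e = {x, y}}\<^sup>*)"

text \<open>The edge \<open>es ! i\<close> joins \<open>vs ! i\<close> to its cyclic successor.  Length 1 is a loop, length 2 a pair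
  of parallel edges.\<close>

definition mcycle :: "('v, 'e) multigraph \<Rightarrow> 'v list \<Rightarrow> 'e list \<Rightarrow> bool" where
  "mcycle G vs es \<longleftrightarrow> es \<noteq> [] \<and> length vs = length es \<and> distinct vs \<and> distinct es \<and>
     set vs \<subseteq> mverts G \<and> set es \<subseteq> medges G \<and>
     (\<forall>i<length es. mends G (es ! i) = {vs ! i, vs ! (Suc i mod length es)})"

definition mtree :: "('v, 'e) multigraph \<Rightarrow> bool" where
  "mtree G \<longleftrightarrow> mconnected G \<and> \<not> (\<exists>vs es. mcycle G vs es)"

definition spanning_trees :: "('v, 'e) multigraph \<Rightarrow> 'e set set" where
  "spanning_trees G = {T. T \<subseteq> medges G \<and> mtree (G\<lparr>medges := T\<rparr>)}"

definition num_spanning_trees :: "('v, 'e) multigraph \<Rightarrow> nat" where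
  "num_spanning_trees G = card (spanning_trees G)"

section \<open>Finitely ramified self-similar sets and their approximating graphs\<close>

locale finitely_ramified =
  fixes m :: nat and f :: "nat \<Rightarrow> 'a::complete_space \<Rightarrow> 'a" and K F0 :: "'a set"
  assumes compact_K: "compact K"
    and connected_K: "connected K"
    and inj_f: "\<And>j. j \<in> {1..m} \<Longrightarrow> inj (f j)"
    and contraction_f: "\<And>j. j \<in> {1..m} \<Longrightarrow> \<exists>c<1. c-lipschitz_on UNIV (f j)"
    and self_similar: "K = (\<Union>j\<in>{1..m}. f j ` K)"
    and F0_subset: "F0 \<subseteq> K"
    and finite_F0: "finite F0"
    and card_F0: "card F0 \<ge> 2"
    and ramification:
      "\<And>j k. j \<in> {1..m} \<Longrightarrow> k \<in> {1..m} \<Longrightarrow> j \<noteq> k \<Longrightarrow>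
         f j ` K \<inter> f k ` K = f j ` F0 \<inter> f k ` F0"
    and boundary_fixed: "\<And>j v. j \<in> {1..m} \<Longrightarrow> v \<in> F0 \<inter> f j ` K \<Longrightarrow> f j v = v"

definition words :: "nat \<Rightarrow> nat \<Rightarrow> nat list set" where
  "words m n = {w. set w \<subseteq> {1..m} \<and> length w = n}"

definition word_map :: "(nat \<Rightarrow> 'a \<Rightarrow> 'a) \<Rightarrow> nat list \<Rightarrow> 'a \<Rightarrow> 'a" where
  "word_map f w = foldr (\<lambda>j g. f j \<circ> g) w id"

text \<open>The edge \<open>(w, e)\<close> is the copy, in the cell of the word \<open>w\<close>, of the edge \<open>e\<close> of the complete
  graph on \<open>F0\<close>; tagging edges with words accounts for their multiplicity.  For \<open>n = 0\<close> the only
  word is empty and the graph is the complete graph on \<open>F0\<close>.\<close>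

definition approx_graph ::
  "nat \<Rightarrow> (nat \<Rightarrow> 'a \<Rightarrow> 'a) \<Rightarrow> 'a set \<Rightarrow> nat \<Rightarrow> ('a, nat list \<times> 'a set) multigraph" where
  "approx_graph m f F0 n =
     \<lparr>mverts = (\<Union>w\<in>words m n. word_map f w ` F0),
      medges = words m n \<times> {e. e \<subseteq> F0 \<and> card e = 2},
      mends = (\<lambda>(w, e). word_map f w ` e)\<rparr>"

end

theory Submission
  imports Defs
begin

text \<open>A bridge of a graph is certified by a cut, a set of vertices left by no other edge; cuts are easy
  to transport along the injective maps \<open>word_map f w\<close> because cells meet only in boundary points.
  If \<open>V\<^sub>1\<close> is a tree, then \<open>F0\<close> has two points and cuts can be glued from cell to cell, so every
  \<open>V\<^sub>n\<close> is a tree.  Otherwise \<open>V\<^sub>1\<close>, being connected, has two different spanning trees.  There is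
  a word \<open>u\<close> of length 2 whose cell misses \<open>F0\<close>, so \<open>V\<^bsub>n+3\<^esub>\<close> contains \<open>m ^ n\<close> pairwise
  disjoint copies of \<open>V\<^sub>1\<close>, in each of which one of the two trees can be chosen freely.\<close>

section \<open>Forests and spanning trees\<close>

text \<open>Keeping \<open>ends\<close> and \<open>T\<close> as separate arguments lets the edge set
  vary while the end function stays fixed. For \<open>mends G\<close> and \<open>medges G\<close>
  this is the relation inside \<open>mconnected\<close>.\<close>

definition edge_conn :: "('e \<Rightarrow> 'v set) \<Rightarrow> 'e set \<Rightarrow> ('v \<times> 'v) set" where
  "edge_conn ends T = {(x, y). \<exists>e\<in>T. ends e = {x, y}}\<^sup>*"

text \<open>Acyclicity in the form that every edge is a bridge, which avoids lists of vertices and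
  edges. Loops are excluded because \<open>edge_conn\<close> is reflexive.\<close>

definition forest :: "('e \<Rightarrow> 'v set) \<Rightarrow> 'e set \<Rightarrow> bool" where
  "forest ends T \<longleftrightarrow> (\<forall>e\<in>T. \<forall>x y. ends e = {x, y} \<longrightarrow> (x, y) \<notin> edge_conn ends (T - {e}))"

lemma edge_conn_refl [simp]: "(x, x) \<in> edge_conn ends T"
  by (simp add: edge_conn_def)

lemma edge_conn_trans:
  "(x, y) \<in> edge_conn ends T \<Longrightarrow> (y, z) \<in> edge_conn ends T \<Longrightarrow> (x, z) \<in> edge_conn ends T"
  by (simp add: edge_conn_def)

lemma edge_conn_edge: "e \<in> T \<Longrightarrow> ends e = {x, y} \<Longrightarrow> (x, y) \<in> edge_conn ends T"
  by (auto simp: edge_conn_def)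

lemma edge_conn_step:
  "(x, y) \<in> edge_conn ends T \<Longrightarrow> e \<in> T \<Longrightarrow> ends e = {y, z} \<Longrightarrow> (x, z) \<in> edge_conn ends T"
  by (metis edge_conn_trans edge_conn_edge)

lemma edge_conn_induct [consumes 1, case_names refl step]:
  assumes "(x, y) \<in> edge_conn ends T" "P x"
    and "\<And>y z e. (x, y) \<in> edge_conn ends T \<Longrightarrow> e \<in> T \<Longrightarrow> ends e = {y, z} \<Longrightarrow> P y \<Longrightarrow> P z"
  shows "P y"
  using assms(1)[unfolded edge_conn_def]
  by (induction rule: rtrancl_induct) (use assms(2,3) in \<open>auto simp: edge_conn_def\<close>)

lemma edge_conn_sym: "(x, y) \<in> edge_conn ends T \<Longrightarrow> (y, x) \<in> edge_conn ends T"
proof (induction rule: edge_conn_induct)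
  case (step y z e)
  then have "(z, y) \<in> edge_conn ends T"
    by (auto intro: edge_conn_edge simp: insert_commute)
  then show ?case
    using step edge_conn_trans by metis
qed simp

text \<open>An edge may be replaced by a whole path, so this serves inclusions and detours
  (\<open>h = id\<close>) as well as copies under a word map.\<close>

lemma edge_conn_map:
  assumes "(x, y) \<in> edge_conn ends T"
    and "\<And>e a b. e \<in> T \<Longrightarrow> ends e = {a, b} \<Longrightarrow> (h a, h b) \<in> edge_conn ends' T'"
  shows "(h x, h y) \<in> edge_conn ends' T'"
  using assms(1) by (induction rule: edge_conn_induct) (auto intro: edge_conn_trans dest: assms(2))

lemma edge_conn_mono: "(x, y) \<in> edge_conn ends T \<Longrightarrow> T \<subseteq> T' \<Longrightarrow> (x, y) \<in> edge_conn ends T'"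
  using edge_conn_map[of x y ends T id ends T'] by (auto intro: edge_conn_edge)

text \<open>Crossing \<open>e\<close> back again leads to a point already reachable without
  \<open>e\<close>, so a single crossing in one of the two directions always suffices.\<close>

lemma edge_conn_insert:
  assumes "(a, b) \<in> edge_conn ends (insert e T)" "ends e = {x, y}"
  shows "(a, b) \<in> edge_conn ends T
    \<or> (a, x) \<in> edge_conn ends T \<and> (y, b) \<in> edge_conn ends T
    \<or> (a, y) \<in> edge_conn ends T \<and> (x, b) \<in> edge_conn ends T"
  using assms(1)
proof (induction rule: edge_conn_induct)
  case (step b c e')
  show ?case
  proof (cases "e' \<in> T")
    case True
    then have "(b, c) \<in> edge_conn ends T"
      using step by (auto intro: edge_conn_edge)
    then show ?thesis
      using step edge_conn_trans by metis
  next
    case False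
    then have "b = x \<and> c = y \<or> b = y \<and> c = x"
      using step assms(2) by (auto simp: doubleton_eq_iff)
    then show ?thesis
      using step by auto
  qed
qed simp

text \<open>If an old edge \<open>e'\<close> stopped being a bridge, a path around it would have to
  cross \<open>e\<close>; closing that path with \<open>e'\<close> would join \<open>x\<close> and
  \<open>y\<close> inside \<open>T\<close>.\<close>

lemma forest_insert:
  assumes "forest ends T" "ends e = {x, y}" "(x, y) \<notin> edge_conn ends T"
  shows "forest ends (insert e T)"
  unfolding forest_def
proof (intro ballI allI impI notI)
  fix e' a b
  assume e': "e' \<in> insert e T" "ends e' = {a, b}"
    and ab: "(a, b) \<in> edge_conn ends (insert e T - {e'})"
  show False
  proof (cases "e' = e")
    case True
    then have "(a, b) \<in> edge_conn ends T"
      using ab edge_conn_mono by fastforce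
    moreover have "a = x \<and> b = y \<or> a = y \<and> b = x"
      using e' True assms(2) by (auto simp: doubleton_eq_iff)
    ultimately show False
      using assms(3) edge_conn_sym by metis
  next
    case False
    then have T: "e' \<in> T" "insert e T - {e'} = insert e (T - {e'})"
      using e' by auto
    have m: "\<And>u v. (u, v) \<in> edge_conn ends (T - {e'}) \<Longrightarrow> (u, v) \<in> edge_conn ends T"
      using edge_conn_mono by fastforce
    have "(a, b) \<notin> edge_conn ends (T - {e'})"
      using assms(1) T(1) e'(2) by (auto simp: forest_def)
    then have "(a, x) \<in> edge_conn ends T \<and> (y, b) \<in> edge_conn ends T
        \<or> (a, y) \<in> edge_conn ends T \<and> (x, b) \<in> edge_conn ends T"
      using edge_conn_insert[OF ab[unfolded T(2)] assms(2)] m by blast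
    moreover have "(a, b) \<in> edge_conn ends T"
      using T e' edge_conn_edge by metis
    ultimately show False
      using assms(3) edge_conn_sym edge_conn_trans by metis
  qed
qed

text \<open>A path avoiding \<open>e\<close> can neither enter nor leave \<open>S\<close>, so it
  cannot join the ends of \<open>e\<close>.\<close>

lemma forest_cutI:
  assumes "\<And>e x y. e \<in> T \<Longrightarrow> ends e = {x, y} \<Longrightarrow>
    \<exists>S. (x \<in> S) \<noteq> (y \<in> S) \<and> (\<forall>e'\<in>T - {e}. ends e' \<subseteq> S \<or> ends e' \<inter> S = {})"
  shows "forest ends T"
  unfolding forest_def
proof (intro ballI allI impI notI)
  fix e x y
  assume e: "e \<in> T" "ends e = {x, y}" and xy: "(x, y) \<in> edge_conn ends (T - {e})"
  obtain S where S: "(x \<in> S) \<noteq> (y \<in> S)" "\<forall>e'\<in>T - {e}. ends e' \<subseteq> S \<or> ends e' \<inter> S = {}"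
    using assms[OF e] by blast
  from xy have "(x \<in> S) = (y \<in> S)"
    by (induction rule: edge_conn_induct) (use S(2) in auto)
  with S(1) show False
    by blast
qed

lemma inj_image_cut:
  assumes "inj h" "C \<subseteq> S \<or> C \<inter> S = {}"
  shows "h ` C \<subseteq> h ` S \<or> h ` C \<inter> h ` S = {}"
  using assms(2) by (auto simp: image_mono simp flip: image_Int[OF assms(1)])

text \<open>Deleting the bridge \<open>e\<close> leaves its ends in different components; the
  component of \<open>x\<close> is the cut.\<close>

lemma forest_cutD:
  assumes "forest ends T" "e \<in> T" "ends e = {x, y}"
    and two: "\<And>e. e \<in> T \<Longrightarrow> card (ends e) = 2"
  obtains S where "x \<in> S" "y \<notin> S" "\<And>e'. e' \<in> T \<Longrightarrow> e' \<noteq> e \<Longrightarrow> ends e' \<subseteq> S \<or> ends e' \<inter> S = {}"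
proof
  let ?S = "{z. (x, z) \<in> edge_conn ends (T - {e})}"
  show "x \<in> ?S" "y \<notin> ?S"
    using assms by (auto simp: forest_def)
  fix e' assume e': "e' \<in> T" "e' \<noteq> e"
  obtain a b where ab: "ends e' = {a, b}"
    using two[OF e'(1)] by (auto simp: card_2_iff)
  have "a \<in> ?S \<longleftrightarrow> b \<in> ?S"
    using e' ab edge_conn_edge[of e' "T - {e}" ends a b] edge_conn_sym edge_conn_trans
    by (metis (lifting) DiffI mem_Collect_eq singletonD)
  then show "ends e' \<subseteq> ?S \<or> ends e' \<inter> ?S = {}"
    by (auto simp: ab)
qed

text \<open>A forest maximal between \<open>T\<close> and \<open>E\<close> works: an edge of
  \<open>E\<close> joining two of its components could still be added by
  \<open>forest_insert\<close>.\<close>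

lemma forest_extend:
  assumes "finite E" "forest ends T" "T \<subseteq> E"
    and two: "\<And>e. e \<in> E \<Longrightarrow> card (ends e) = 2"
  obtains T' where "T \<subseteq> T'" "T' \<subseteq> E" "forest ends T'"
    "\<And>x y. (x, y) \<in> edge_conn ends E \<Longrightarrow> (x, y) \<in> edge_conn ends T'"
proof -
  let ?A = "{T'. T \<subseteq> T' \<and> T' \<subseteq> E \<and> forest ends T'}"
  have "finite ?A" "T \<in> ?A"
    using assms by (auto intro: finite_subset[of _ "Pow E"])
  then obtain T' where T': "T' \<in> ?A" "\<And>U. U \<in> ?A \<Longrightarrow> T' \<subseteq> U \<Longrightarrow> U = T'"
    using finite_has_maximal[of ?A] by (metis (no_types, lifting) empty_iff)
  have "(x, y) \<in> edge_conn ends T'" if "e \<in> E" "ends e = {x, y}" for e x y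
  proof (rule ccontr)
    assume *: "(x, y) \<notin> edge_conn ends T'"
    then have "insert e T' \<in> ?A"
      using T'(1) that forest_insert[of ends T' e x y] by auto
    then have "e \<in> T'"
      using T'(2) by blast
    then show False
      using * that edge_conn_edge by metis
  qed
  then have "(x, y) \<in> edge_conn ends T'" if "(x, y) \<in> edge_conn ends E" for x y
    using edge_conn_map[OF that, of id ends T'] by auto
  then show ?thesis
    using that T'(1) by blast
qed

section \<open>Cycles as lists compared with bridges\<close>

lemma mcycle_imp_not_forest:
  assumes "mcycle G vs es"
  shows "\<not> forest (mends G) (medges G)"
proof -
  let ?k = "length es" and ?e = "es ! 0"
  have k: "?k > 0" "length vs = ?k" "distinct es" "set es \<subseteq> medges G"
    and ends: "\<And>i. i < ?k \<Longrightarrow> mends G (es ! i) = {vs ! i, vs ! (Suc i mod ?k)}"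
    using assms by (auto simp: mcycle_def)
  have mem: "es ! i \<in> medges G - {?e}" if "0 < i" "i < ?k" for i
    using that k by (auto simp: nth_eq_iff_index_eq)
  \<comment> \<open>Walking forward from \<open>vs ! 1\<close> uses only edges of positive index, so
    \<open>es ! 0\<close> is avoided.\<close>
  have path: "Suc i < ?k \<Longrightarrow> (vs ! 1, vs ! Suc i) \<in> edge_conn (mends G) (medges G - {?e})" for i
  proof (induction i)
    case (Suc i)
    then have "(vs ! 1, vs ! Suc i) \<in> edge_conn (mends G) (medges G - {?e})"
      by simp
    moreover have "es ! Suc i \<in> medges G - {?e}"
      using Suc.prems by (intro mem) auto
    moreover have "mends G (es ! Suc i) = {vs ! Suc i, vs ! Suc (Suc i)}"
      using ends[of "Suc i"] Suc.prems by simp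
    ultimately show ?case
      by (rule edge_conn_step)
  qed simp
  \<comment> \<open>The index \<open>1 mod ?k\<close> treats loops together with longer cycles: for
    \<open>?k = 1\<close> both points are \<open>vs ! 0\<close>.\<close>
  have "(vs ! (1 mod ?k), vs ! 0) \<in> edge_conn (mends G) (medges G - {?e})"
  proof (cases "?k = 1")
    case False
    then have "?k - 1 = Suc (?k - 2)" "Suc (?k - 2) < ?k"
      using k(1) by linarith+
    then have "(vs ! 1, vs ! (?k - 1)) \<in> edge_conn (mends G) (medges G - {?e})"
      using path[of "?k - 2"] by auto
    moreover have "mends G (es ! (?k - 1)) = {vs ! (?k - 1), vs ! 0}"
      using ends[of "?k - 1"] k by auto
    moreover have "es ! (?k - 1) \<in> medges G - {?e}"
      using False k(1) by (intro mem; linarith)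
    ultimately have "(vs ! 1, vs ! 0) \<in> edge_conn (mends G) (medges G - {?e})"
      using edge_conn_step by metis
    moreover have "1 mod ?k = 1"
      using False k by (cases "?k") auto
    ultimately show ?thesis
      by simp
  qed auto
  moreover have "mends G ?e = {vs ! (1 mod ?k), vs ! 0}" "?e \<in> medges G"
    using ends[of 0] k by (auto simp: insert_commute)
  ultimately show ?thesis
    by (auto simp: forest_def)
qed

text \<open>A shortest path joining the ends of \<open>e\<close> in the complement of \<open>e\<close> closes up to a cycle.\<close>

lemma not_forest_imp_mcycle:
  assumes "\<not> forest (mends G) (medges G)" "\<And>e. e \<in> medges G \<Longrightarrow> mends G e \<subseteq> mverts G"
  shows "\<exists>vs es. mcycle G vs es"
proof -
  obtain e x y where e: "e \<in> medges G" "mends G e = {x, y}"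
    and xy: "(x, y) \<in> edge_conn (mends G) (medges G - {e})"
    using assms(1) by (auto simp: forest_def)
  define R where "R = {(x, y). \<exists>e'\<in>medges G - {e}. mends G e' = {x, y}}"
  have "\<exists>n. (x, y) \<in> R ^^ n"
    using xy by (auto simp: edge_conn_def R_def rtrancl_power)
  \<comment> \<open>Minimality makes the vertices distinct: between two visits of one vertex the
    walk could be cut short.\<close>
  define n where "n = (LEAST n. (x, y) \<in> R ^^ n)"
  have n: "(x, y) \<in> R ^^ n" and least: "\<And>l. (x, y) \<in> R ^^ l \<Longrightarrow> n \<le> l"
    using \<open>\<exists>n. _\<close> by (auto simp: n_def intro: LeastI_ex Least_le)
  obtain g where g: "g 0 = x" "g n = y" "\<And>i. i < n \<Longrightarrow> (g i, g (Suc i)) \<in> R"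
    using n by (auto simp: relpow_fun_conv)
  have seg: "(g i, g (i + d)) \<in> R ^^ d" if "i + d \<le> n" for i d
    unfolding relpow_fun_conv using that g(3) by (intro exI[of _ "\<lambda>l. g (i + l)"]) auto
  have "g i \<noteq> g j" if "i < j" "j \<le> n" for i j
  proof
    assume "g i = g j"
    have "(x, g i) \<in> R ^^ i" "(g j, y) \<in> R ^^ (n - j)"
      using seg[of 0 i] seg[of j "n - j"] that g by auto
    then have "(x, y) \<in> R ^^ (i + (n - j))"
      using \<open>g i = g j\<close> by (auto simp: relpow_add)
    from least[OF this] show False
      using that by auto
  qed
  then have inj: "inj_on g {..n}"
    by (intro inj_onI) (metis atMost_iff linorder_neqE_nat)
  have "\<forall>i. \<exists>e'. i < n \<longrightarrow> e' \<in> medges G - {e} \<and> mends G e' = {g i, g (Suc i)}"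
    using g(3) unfolding R_def by blast
  then obtain h where h: "\<And>i. i < n \<Longrightarrow> h i \<in> medges G - {e} \<and> mends G (h i) = {g i, g (Suc i)}"
    by metis
  \<comment> \<open>Equal edges have equal pairs of consecutive vertices, and distinct vertices
    determine their positions.\<close>
  have hinj: "inj_on h {..<n}"
  proof (intro inj_onI)
    fix i j assume ij: "i \<in> {..<n}" "j \<in> {..<n}" "h i = h j"
    then have "{g i, g (Suc i)} = {g j, g (Suc j)}"
      using h by (metis lessThan_iff)
    then have "g ` {i, Suc i} = g ` {j, Suc j}"
      by simp
    then have "{i, Suc i} = {j, Suc j}"
      using inj_on_image_eq_iff[OF inj, of "{i, Suc i}" "{j, Suc j}"] ij by auto
    then show "i = j"
      by (auto simp: doubleton_eq_iff)
  qed
  \<comment> \<open>The last edge \<open>e\<close> leads from \<open>g n = y\<close> back to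
    \<open>g 0 = x\<close>.\<close>
  let ?vs = "map g [0..<Suc n]" and ?es = "map h [0..<n] @ [e]"
  have gv: "g i \<in> mverts G" if "i \<le> n" for i
  proof (cases "i = n")
    case True
    then show ?thesis
      using e g assms(2) by blast
  next
    case False
    then show ?thesis
      using h[of i] assms(2)[of "h i"] that by auto
  qed
  have "mcycle G ?vs ?es"
    unfolding mcycle_def
  proof (intro conjI allI impI)
    show "distinct ?vs"
      using inj by (auto simp: distinct_map atLeast0_lessThan_Suc inj_on_def simp del: upt_Suc)
    show "distinct ?es"
      using hinj h by (fastforce simp: distinct_map atLeast0LessThan)
    show "set ?vs \<subseteq> mverts G"
      using gv by (auto simp del: upt_Suc)
    show "set ?es \<subseteq> medges G"
      using h e by auto
    fix i assume i: "i < length ?es"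
    show "mends G (?es ! i) = {?vs ! i, ?vs ! (Suc i mod length ?es)}"
    proof (cases "i < n")
      case True
      then show ?thesis
        using h[OF True] by (simp add: nth_append del: upt_Suc)
    next
      case False
      then have "i = n"
        using i by auto
      then show ?thesis
        using e g by (auto simp: nth_append simp del: upt_Suc)
    qed
  qed auto
  then show ?thesis
    by blast
qed

section \<open>Trees and spanning trees in terms of forests\<close>

lemma mtree_iff_forest:
  assumes "\<And>e. e \<in> medges G \<Longrightarrow> mends G e \<subseteq> mverts G"
  shows "mtree G \<longleftrightarrow> mconnected G \<and> forest (mends G) (medges G)"
  using mcycle_imp_not_forest[of G] not_forest_imp_mcycle[of G] assms
  unfolding mtree_def by blast

lemma mconnected_iff_edge_conn:
  "mconnected G \<longleftrightarrow> mverts G \<noteq> {} \<and>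
    (\<forall>u\<in>mverts G. \<forall>v\<in>mverts G. (u, v) \<in> edge_conn (mends G) (medges G))"
  by (simp add: mconnected_def edge_conn_def)

lemma spanning_trees_iff:
  assumes "\<And>e. e \<in> medges G \<Longrightarrow> mends G e \<subseteq> mverts G"
  shows "T \<in> spanning_trees G \<longleftrightarrow> T \<subseteq> medges G \<and> mverts G \<noteq> {} \<and>
    (\<forall>u\<in>mverts G. \<forall>v\<in>mverts G. (u, v) \<in> edge_conn (mends G) T) \<and> forest (mends G) T"
proof -
  have "mtree (G\<lparr>medges := T\<rparr>) \<longleftrightarrow> mconnected (G\<lparr>medges := T\<rparr>) \<and> forest (mends G) T"
    if "T \<subseteq> medges G"
    using mtree_iff_forest[of "G\<lparr>medges := T\<rparr>"] assms that by auto
  then show ?thesis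
    by (auto simp: spanning_trees_def mconnected_iff_edge_conn)
qed


section \<open>Words and cells\<close>

lemma word_map_simps [simp]:
  "word_map f [] = id"
  "word_map f (j # w) = f j \<circ> word_map f w"
  "word_map f (v @ w) = word_map f v \<circ> word_map f w"
  by (induction v) (auto simp: word_map_def)

lemma words_0 [simp]: "words m 0 = {[]}"
  by (auto simp: words_def)

lemma Cons_in_words_iff [simp]: "j # w \<in> words m (Suc n) \<longleftrightarrow> j \<in> {1..m} \<and> w \<in> words m n"
  by (auto simp: words_def)

lemma words_SucE:
  assumes "w \<in> words m (Suc n)"
  obtains j v where "w = j # v" "j \<in> {1..m}" "v \<in> words m n"
  using assms by (cases w) (auto simp: words_def)

lemma append_in_words: "v \<in> words m k \<Longrightarrow> w \<in> words m n \<Longrightarrow> v @ w \<in> words m (k + n)"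
  by (auto simp: words_def)

lemma finite_words: "finite (words m n)"
  and card_words: "card (words m n) = m ^ n"
  using finite_lists_length_eq[of "{1..m}" n] card_lists_length_eq[of "{1..m}" n]
  by (simp_all add: words_def)

context finitely_ramified
begin

definition V :: "nat \<Rightarrow> 'a set" where
  "V n = (\<Union>w\<in>words m n. word_map f w ` F0)"

definition E :: "nat \<Rightarrow> (nat list \<times> 'a set) set" where
  "E n = words m n \<times> {e. e \<subseteq> F0 \<and> card e = 2}"

definition cell_ends :: "nat list \<times> 'a set \<Rightarrow> 'a set" where
  "cell_ends = (\<lambda>(w, e). word_map f w ` e)"

lemma approx_graph_sel [simp]:
  "mverts (approx_graph m f F0 n) = V n"
  "medges (approx_graph m f F0 n) = E n"
  "mends (approx_graph m f F0 n) = cell_ends"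
  by (simp_all add: approx_graph_def V_def E_def cell_ends_def)

abbreviation shift :: "nat list \<Rightarrow> nat list \<times> 'a set \<Rightarrow> nat list \<times> 'a set" where
  "shift w \<equiv> apfst ((@) w)"

lemma cell_ends_shift: "cell_ends (shift w e) = word_map f w ` cell_ends e"
  by (cases e) (simp add: cell_ends_def image_image o_def)

lemma inj_shift: "inj (shift w)"
  by (auto intro!: injI)

lemma shift_in_E: "w \<in> words m k \<Longrightarrow> e \<in> E n \<Longrightarrow> shift w e \<in> E (k + n)"
  by (cases e) (auto simp: E_def intro: append_in_words)

section \<open>How the cells of words meet each other and \<open>F0\<close>\<close>

lemma inj_word_map: "w \<in> words m n \<Longrightarrow> inj (word_map f w)"
proof (induction n arbitrary: w)
  case (Suc n)
  then show ?case
    by (metis words_SucE word_map_simps(2) inj_compose inj_f)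
qed simp

lemma word_map_in_K: "w \<in> words m n \<Longrightarrow> x \<in> K \<Longrightarrow> word_map f w x \<in> K"
proof (induction n arbitrary: w)
  case (Suc n)
  then obtain j v where "w = j # v" "j \<in> {1..m}" "v \<in> words m n"
    by (blast elim: words_SucE)
  then show ?case
    using Suc self_similar by fastforce
qed simp

text \<open>A boundary point in a cell is fixed by the map of the first letter, so injectivity
  removes that letter; repeating this removes the whole word.\<close>

lemma word_map_eq_if_in_F0: "w \<in> words m n \<Longrightarrow> a \<in> K \<Longrightarrow> word_map f w a \<in> F0 \<Longrightarrow> word_map f w a = a"
proof (induction n arbitrary: w)
  case (Suc n)
  then obtain j v where w: "w = j # v" "j \<in> {1..m}" "v \<in> words m n"
    by (blast elim: words_SucE)
  let ?b = "word_map f w a"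
  have "?b \<in> f j ` K"
    using w word_map_in_K Suc.prems by auto
  then have "f j ?b = f j (word_map f v a)"
    using boundary_fixed[of j ?b] Suc.prems w by auto
  then have "?b = word_map f v a"
    using inj_f[OF w(2)] by (auto dest: injD)
  then show ?case
    using Suc w by metis
qed simp

lemma f_overlap:
  assumes "j \<in> {1..m}" "k \<in> {1..m}" "j \<noteq> k" "a \<in> K" "b \<in> K" "f j a = f k b"
  shows "a \<in> F0"
proof -
  have "f j a \<in> f j ` K \<inter> f k ` K"
    using assms(4-6) by (metis IntI imageI)
  then have "f j a \<in> f j ` F0"
    using ramification[OF assms(1-3)] by blast
  then show ?thesis
    using inj_f[OF assms(1)] by (auto dest: injD)
qed

text \<open>Common first letters cancel by injectivity. At the first difference
  \<open>f_overlap\<close> puts the image of \<open>a\<close> under the remaining word into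
  \<open>F0\<close>, and \<open>word_map_eq_if_in_F0\<close> identifies that image with
  \<open>a\<close>.\<close>

lemma word_map_overlap:
  "w \<in> words m n \<Longrightarrow> w' \<in> words m n \<Longrightarrow> w \<noteq> w' \<Longrightarrow> a \<in> K \<Longrightarrow> b \<in> K \<Longrightarrow>
    word_map f w a = word_map f w' b \<Longrightarrow> a \<in> F0"
proof (induction n arbitrary: w w')
  case (Suc n)
  obtain j v where w: "w = j # v" "j \<in> {1..m}" "v \<in> words m n"
    using Suc.prems by (blast elim: words_SucE)
  obtain k v' where w': "w' = k # v'" "k \<in> {1..m}" "v' \<in> words m n"
    using Suc.prems by (blast elim: words_SucE)
  have eq: "f j (word_map f v a) = f k (word_map f v' b)"
    using Suc.prems w w' by simp
  show ?case
  proof (cases "j = k")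
    case True
    then have "word_map f v a = word_map f v' b"
      using eq inj_f[OF w(2)] by (auto dest: injD)
    then show ?thesis
      using Suc w w' True by blast
  next
    case False
    have "word_map f v a \<in> F0"
      using f_overlap[OF w(2) w'(2) False _ _ eq] word_map_in_K w w' Suc.prems by blast
    then show ?thesis
      using word_map_eq_if_in_F0 w Suc.prems by metis
  qed
qed simp

lemma fixed_point_unique:
  assumes "j \<in> {1..m}" "f j x = x" "f j y = y"
  shows "x = y"
proof -
  obtain c where c: "c < 1" "c-lipschitz_on UNIV (f j)"
    using contraction_f[OF assms(1)] by blast
  then have "dist x y \<le> c * dist x y"
    using lipschitz_onD[OF c(2), of x y] assms by simp
  then have "(1 - c) * dist x y \<le> 0"
    by (simp add: algebra_simps)
  then show ?thesis
    using c(1) by (simp add: mult_le_0_iff)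
qed

lemma F0_fixed_by:
  assumes "v \<in> F0"
  obtains j where "j \<in> {1..m}" "f j v = v"
proof -
  obtain j where "j \<in> {1..m}" "v \<in> f j ` K"
    using assms F0_subset self_similar by blast
  then show ?thesis
    using that boundary_fixed[of j v] assms by blast
qed

section \<open>Vertices at each level, and a cell away from \<open>F0\<close>\<close>

lemma F0_subset_V: "F0 \<subseteq> V n"
proof
  fix v assume v: "v \<in> F0"
  obtain j where j: "j \<in> {1..m}" "f j v = v"
    using F0_fixed_by[OF v] .
  \<comment> \<open>Repeating the letter that fixes \<open>v\<close> keeps \<open>v\<close> a vertex
    at every level.\<close>
  have "word_map f (replicate n j) v = v"
    using j by (induction n) auto
  moreover have "replicate n j \<in> words m n"
    using j by (auto simp: words_def)
  ultimately show "v \<in> V n"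
    using v unfolding V_def by (metis UN_I image_eqI)
qed

lemma F0_not_empty: "F0 \<noteq> {}"
  using card_F0 by auto

lemma V_not_empty: "V n \<noteq> {}"
  using F0_subset_V F0_not_empty by blast

lemma V_subset_K: "V n \<subseteq> K"
  using word_map_in_K F0_subset unfolding V_def by blast

lemma V_Suc: "V (Suc n) = (\<Union>j\<in>{1..m}. f j ` V n)"
proof (intro equalityI subsetI)
  fix x assume "x \<in> V (Suc n)"
  then obtain w a where "w \<in> words m (Suc n)" "a \<in> F0" "x = word_map f w a"
    unfolding V_def by blast
  then show "x \<in> (\<Union>j\<in>{1..m}. f j ` V n)"
    unfolding V_def by (fastforce elim!: words_SucE)
next
  fix x assume "x \<in> (\<Union>j\<in>{1..m}. f j ` V n)"
  then obtain j w a where j: "j \<in> {1..m}" "w \<in> words m n" "a \<in> F0" "x = f j (word_map f w a)"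
    unfolding V_def by blast
  then have "j # w \<in> words m (Suc n)" "x = word_map f (j # w) a"
    by auto
  with j show "x \<in> V (Suc n)"
    unfolding V_def by blast
qed

lemma m_pos: "m > 0"
proof -
  obtain v where "v \<in> F0"
    using F0_not_empty by blast
  then obtain j where "j \<in> {1..m}"
    by (rule F0_fixed_by)
  then show ?thesis
    by simp
qed

text \<open>Take letters \<open>j\<close>, \<open>k\<close> fixing different boundary points
  \<open>a\<close>, \<open>b\<close>. A boundary point in the cell of \<open>[j, k]\<close> is fixed
  by \<open>f j\<close>, hence equals \<open>a\<close>; cancelling \<open>f j\<close> puts
  \<open>a\<close> into the cell of \<open>k\<close>, so \<open>f k\<close> fixes both
  \<open>a\<close> and \<open>b\<close>.\<close>

lemma exists_interior_word:
  obtains u where "u \<in> words m 2" "\<And>x. x \<in> K \<Longrightarrow> word_map f u x \<notin> F0"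
proof -
  obtain a b where ab: "a \<in> F0" "b \<in> F0" "a \<noteq> b"
    using card_F0 by (metis card_le_Suc0_iff_eq finite_F0 not_less_eq_eq numeral_2_eq_2)
  obtain j where j: "j \<in> {1..m}" "f j a = a"
    using F0_fixed_by ab by blast
  obtain k where k: "k \<in> {1..m}" "f k b = b"
    using F0_fixed_by ab by blast
  have "word_map f [j, k] x \<notin> F0" if "x \<in> K" for x
  proof
    assume F: "word_map f [j, k] x \<in> F0"
    have fk: "f k x \<in> K"
      using k that self_similar by blast
    then have "f j (f j (f k x)) = f j (f k x)"
      using boundary_fixed[OF j(1), of "f j (f k x)"] F by auto
    then have "f j (f k x) = a"
      using fixed_point_unique[OF j(1)] j by blast
    then have "f k x = a"
      using j inj_f[OF j(1)] by (metis injD)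
    then have "f k a = a"
      using boundary_fixed[OF k(1), of a] ab that by auto
    then show False
      using fixed_point_unique[OF k(1)] k ab by blast
  qed
  moreover have "[j, k] \<in> words m 2"
    using j k by (auto simp: words_def)
  ultimately show ?thesis
    using that by blast
qed

section \<open>The approximating graphs\<close>

lemma card_cell_ends: "e \<in> E n \<Longrightarrow> card (cell_ends e) = 2"
proof -
  assume "e \<in> E n"
  then obtain w p where e: "e = (w, p)" "w \<in> words m n" "card p = 2"
    by (auto simp: E_def)
  have "inj_on (word_map f w) p"
    using inj_word_map[OF e(2)] by (rule inj_on_subset) simp
  then show ?thesis
    by (simp add: e cell_ends_def card_image)
qed

lemma cell_ends_subset: "e \<in> E n \<Longrightarrow> cell_ends e \<subseteq> V n"
  by (cases e) (auto simp: E_def V_def cell_ends_def)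

lemma finite_E: "finite (E n)"
proof -
  have "finite {e. e \<subseteq> F0 \<and> card e = 2}"
    using finite_F0 by simp
  then show ?thesis
    unfolding E_def using finite_words by (rule finite_cartesian_product[rotated])
qed

lemma edge_conn_shift:
  assumes "(x, y) \<in> edge_conn cell_ends T"
  shows "(word_map f w x, word_map f w y) \<in> edge_conn cell_ends (shift w ` T)"
proof (rule edge_conn_map[OF assms])
  fix e a b assume e: "e \<in> T" "cell_ends e = {a, b}"
  have "cell_ends (shift w e) = {word_map f w a, word_map f w b}"
    by (simp only: cell_ends_shift e(2)) simp
  with e show "(word_map f w a, word_map f w b) \<in> edge_conn cell_ends (shift w ` T)"
    by (intro edge_conn_edge[of "shift w e"]) auto
qed

text \<open>If some cells could not be reached from the others, the two groups of cells would be disjoint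
  closed sets covering \<open>K\<close>.\<close>

lemma V_edge_conn: "x \<in> V n \<Longrightarrow> y \<in> V n \<Longrightarrow> (x, y) \<in> edge_conn cell_ends (E n)"
proof (induction n arbitrary: x y)
  case 0
  show ?case
  proof (cases "x = y")
    case False
    then show ?thesis
      using 0 by (intro edge_conn_edge[of "([], {x, y})"]) (auto simp: V_def E_def cell_ends_def)
  qed simp
next
  case (Suc n)
  have cell: "(f j a, f j b) \<in> edge_conn cell_ends (E (Suc n))"
    if "j \<in> {1..m}" "a \<in> V n" "b \<in> V n" for j a b
  proof -
    have "[j] \<in> words m 1"
      using that by (simp add: words_def)
    then have "shift [j] ` E n \<subseteq> E (Suc n)"
      using shift_in_E[of "[j]" 1 _ n] by auto
    then show ?thesis
      using edge_conn_shift[OF Suc.IH[OF that(2,3)], of "[j]"] edge_conn_mono by fastforce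
  qed
  \<comment> \<open>The letters whose cells are reached from \<open>x\<close>; by
    \<open>cell\<close>, reaching one vertex of a cell reaches all of them.\<close>
  define J where "J = {j \<in> {1..m}. \<exists>a\<in>V n. (x, f j a) \<in> edge_conn cell_ends (E (Suc n))}"
  have J: "(x, f j a) \<in> edge_conn cell_ends (E (Suc n))" if j: "j \<in> J" and a: "a \<in> V n" for j a
  proof -
    obtain b where "b \<in> V n" "(x, f j b) \<in> edge_conn cell_ends (E (Suc n))" "j \<in> {1..m}"
      using j by (auto simp: J_def)
    then show ?thesis
      using cell[OF _ _ a] edge_conn_trans by metis
  qed
  let ?A = "\<Union>j\<in>J. f j ` K" and ?B = "\<Union>j\<in>{1..m} - J. f j ` K"
  have "J \<subseteq> {1..m}"
    by (auto simp: J_def)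
  have "compact (f j ` K)" if j: "j \<in> {1..m}" for j
  proof -
    obtain c where "c-lipschitz_on UNIV (f j)"
      using contraction_f[OF j] by blast
    then have "continuous_on K (f j)"
      using lipschitz_on_continuous_on continuous_on_subset by blast
    then show ?thesis
      using compact_continuous_image compact_K by blast
  qed
  then have "closed ?A" "closed ?B"
    using \<open>J \<subseteq> {1..m}\<close> finite_subset[of J "{1..m}"]
    by (fastforce intro!: closed_UN intro: compact_imp_closed)+
  moreover have "?A \<inter> ?B = {}"
  proof (rule ccontr)
    assume "?A \<inter> ?B \<noteq> {}"
    then obtain j k a b where jk: "j \<in> J" "k \<in> {1..m} - J" "a \<in> K" "b \<in> K" "f j a = f k b"
      by blast
    then have "j \<in> {1..m}" "j \<noteq> k"
      using \<open>J \<subseteq> {1..m}\<close> by auto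
    \<comment> \<open>A common point comes from \<open>F0\<close> in both cells, so it is a vertex,
      and cell \<open>k\<close> would be reached through cell \<open>j\<close>.\<close>
    then have "a \<in> V n" "b \<in> V n"
      using f_overlap[of j k a b] f_overlap[of k j b a] jk F0_subset_V by auto
    then show False
      using J[of j a] jk by (auto simp: J_def)
  qed
  moreover have "K = ?A \<union> ?B"
  proof -
    have "(\<Union>j\<in>{1..m}. f j ` K) = ?A \<union> ?B"
      using \<open>J \<subseteq> {1..m}\<close> by blast
    then show ?thesis
      using self_similar by simp
  qed
  moreover obtain j a where j: "j \<in> {1..m}" "a \<in> V n" "x = f j a"
    using Suc.prems V_Suc by blast
  then have "j \<in> J"
    unfolding J_def by (auto intro!: bexI[of _ a])
  then have "?A \<noteq> {}"
    using j V_subset_K by blast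
  moreover have "B = {}"
    if "closed A" "closed B" "A \<inter> B = {}" "K = A \<union> B" "A \<noteq> {}" for A B
    using connected_closedD[OF connected_K, of A B] that by blast
  ultimately have "?B = {}"
    by metis
  moreover have "K \<noteq> {}"
    using F0_not_empty F0_subset by blast
  ultimately have "J = {1..m}"
    using \<open>J \<subseteq> {1..m}\<close> by auto
  then show ?case
    using Suc.prems(2) J unfolding V_Suc by blast
qed

lemma spanning_trees_approx_iff:
  "T \<in> spanning_trees (approx_graph m f F0 n) \<longleftrightarrow> T \<subseteq> E n \<and>
    (\<forall>u\<in>V n. \<forall>v\<in>V n. (u, v) \<in> edge_conn cell_ends T) \<and> forest cell_ends T"
  using spanning_trees_iff[of "approx_graph m f F0 n" T] cell_ends_subset[of _ n] V_not_empty[of n]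
  by simp

lemma mtree_approx_iff: "mtree (approx_graph m f F0 n) \<longleftrightarrow> forest cell_ends (E n)"
  using mtree_iff_forest[of "approx_graph m f F0 n"] cell_ends_subset[of _ n] V_not_empty[of n]
    V_edge_conn[of _ n]
  by (simp add: mconnected_iff_edge_conn)

text \<open>The extra edge set \<open>E'\<close> makes it possible to prescribe edges to be
  contained and edges to be avoided.\<close>

lemma forest_extends_to_spanning_tree:
  assumes "forest cell_ends T" "T \<subseteq> E'" "E' \<subseteq> E n"
    and "\<And>u v. u \<in> V n \<Longrightarrow> v \<in> V n \<Longrightarrow> (u, v) \<in> edge_conn cell_ends E'"
  obtains T' where "T \<subseteq> T'" "T' \<subseteq> E'" "T' \<in> spanning_trees (approx_graph m f F0 n)"
proof -
  obtain T' where "T \<subseteq> T'" "T' \<subseteq> E'" "forest cell_ends T'"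
    "\<And>x y. (x, y) \<in> edge_conn cell_ends E' \<Longrightarrow> (x, y) \<in> edge_conn cell_ends T'"
    using forest_extend[OF finite_subset[OF assms(3) finite_E] assms(1,2)] card_cell_ends assms(3)
    by (metis subsetD)
  moreover from this have "T' \<in> spanning_trees (approx_graph m f F0 n)"
    unfolding spanning_trees_approx_iff using assms(3,4) by blast
  ultimately show ?thesis
    using that by blast
qed

text \<open>Every edge is a bridge, so leaving one out disconnects its two ends.\<close>

lemma spanning_trees_eq_if_forest:
  assumes "forest cell_ends (E n)"
  shows "spanning_trees (approx_graph m f F0 n) = {E n}"
proof -
  have "T = E n" if T: "T \<in> spanning_trees (approx_graph m f F0 n)" for T
  proof (rule ccontr)
    assume "T \<noteq> E n"
    moreover have "T \<subseteq> E n"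
      using T by (simp add: spanning_trees_approx_iff)
    ultimately obtain e where e: "e \<in> E n" "T \<subseteq> E n - {e}"
      by blast
    obtain x y where xy: "cell_ends e = {x, y}"
      using card_cell_ends[OF e(1)] by (auto simp: card_2_iff)
    then have "x \<in> V n" "y \<in> V n"
      using cell_ends_subset[OF e(1)] by auto
    then have "(x, y) \<in> edge_conn cell_ends T"
      using T by (simp add: spanning_trees_approx_iff)
    then have "(x, y) \<in> edge_conn cell_ends (E n - {e})"
      using e(2) by (rule edge_conn_mono)
    then show False
      using assms e(1) xy by (auto simp: forest_def)
  qed
  moreover have "E n \<in> spanning_trees (approx_graph m f F0 n)"
    using assms V_edge_conn by (auto simp: spanning_trees_approx_iff)
  ultimately show ?thesis
    by blast
qed

section \<open>The case of a tree\<close>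

text \<open>Three points of \<open>F0\<close> would give a triangle in the cell of the letter
  1.\<close>

lemma card_F0_if_forest:
  assumes "forest cell_ends (E 1)"
  shows "card F0 = 2"
proof (rule ccontr)
  assume "card F0 \<noteq> 2"
  then have "3 \<le> card F0"
    using card_F0 by simp
  then obtain P where "P \<subseteq> F0" "card P = 3"
    by (metis obtain_subset_with_card_n)
  then obtain p q r where pqr: "p \<in> F0" "q \<in> F0" "r \<in> F0" "p \<noteq> q" "p \<noteq> r" "q \<noteq> r"
    by (auto simp: card_3_iff)
  have w: "[1] \<in> words m 1"
    using m_pos by (auto simp: words_def)
  have E: "([1], {a, b}) \<in> E 1" if "a \<in> F0" "b \<in> F0" "a \<noteq> b" for a b
    using that w by (auto simp: E_def)
  have ends: "cell_ends ([1], {a, b}) = {f 1 a, f 1 b}" for a b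
    by (simp add: cell_ends_def)
  let ?e = "([1], {p, q})"
  have "([1], {p, r}) \<in> E 1 - {?e}" "([1], {r, q}) \<in> E 1 - {?e}"
    using E pqr by (auto simp: doubleton_eq_iff)
  then have "(f 1 p, f 1 r) \<in> edge_conn cell_ends (E 1 - {?e})"
    "(f 1 r, f 1 q) \<in> edge_conn cell_ends (E 1 - {?e})"
    using ends by (blast intro: edge_conn_edge)+
  then have "(f 1 p, f 1 q) \<in> edge_conn cell_ends (E 1 - {?e})"
    by (rule edge_conn_trans)
  then show False
    using assms ends E[OF pqr(1,2,4)] unfolding forest_def by blast
qed

text \<open>A cut isolating an edge in the cell \<open>j\<close> of \<open>V n\<close> either does not separate the two boundary
  points, and then is transported by \<open>f j\<close>, or is combined with a cut isolating the edge \<open>j\<close>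
  of \<open>V 1\<close>.\<close>

lemma forest_Suc:
  assumes F1: "forest cell_ends (E 1)" and Fn: "forest cell_ends (E n)"
  shows "forest cell_ends (E (Suc n))"
proof (rule forest_cutI)
  obtain p q where F0: "F0 = {p, q}" "p \<noteq> q"
    using card_F0_if_forest[OF F1] by (auto simp: card_2_iff)
  \<comment> \<open>With two boundary points each cell contributes one edge, so the edges are
    indexed by words alone.\<close>
  have E: "E l = words m l \<times> {F0}" for l
    using card_F0_if_forest[OF F1] card_subset_eq[OF finite_F0] unfolding E_def by auto
  have pq: "p \<in> V n" "q \<in> V n"
    using F0_subset_V F0 by auto
  have overlap: "c \<in> {p, q}" "d \<in> {p, q}"
    if "j \<in> {1..m}" "k \<in> {1..m}" "j \<noteq> k" "c \<in> V n" "d \<in> V n" "f j c = f k d" for j k c d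
    using f_overlap[of j k c d] f_overlap[of k j d c] that V_subset_K[of n] F0 by auto
  fix e x y
  assume e: "e \<in> E (Suc n)" "cell_ends e = {x, y}"
  obtain j w where jw: "e = (j # w, F0)" "j \<in> {1..m}" "w \<in> words m n"
    using e(1) unfolding E by (auto elim!: words_SucE)
  have wE: "(w, F0) \<in> E n"
    using jw by (simp add: E)
  obtain a b where ab: "cell_ends (w, F0) = {a, b}" "a \<in> V n" "b \<in> V n"
    using cell_ends_subset[OF wE] by (auto simp: cell_ends_def F0)
  have "{x, y} = {f j a, f j b}"
    using e(2) ab(1) jw(1) by (simp add: cell_ends_def image_comp[symmetric])
  then have xy: "x = f j a \<and> y = f j b \<or> x = f j b \<and> y = f j a"
    by (auto simp: doubleton_eq_iff)
  obtain S where S: "a \<in> S" "b \<notin> S"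
    "\<And>e'. e' \<in> E n \<Longrightarrow> e' \<noteq> (w, F0) \<Longrightarrow> cell_ends e' \<subseteq> S \<or> cell_ends e' \<inter> S = {}"
    using forest_cutD[OF Fn wE ab(1)] card_cell_ends by metis
  \<comment> \<open>An elimination rule: an edge different from \<open>e\<close> lies in cell
    \<open>j\<close>, where it respects \<open>S\<close>, or in another cell
    \<open>k\<close>.\<close>
  have other: Q
    if e': "e' \<in> E (Suc n) - {e}"
      and same_cell: "\<And>v. e' = (j # v, F0) \<Longrightarrow> (v, F0) \<in> E n \<Longrightarrow> cell_ends e' = f j ` cell_ends (v, F0) \<Longrightarrow>
        cell_ends (v, F0) \<subseteq> V n \<Longrightarrow>
        cell_ends (v, F0) \<subseteq> S \<or> cell_ends (v, F0) \<inter> S = {} \<Longrightarrow> Q"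
      and other_cell: "\<And>k C. k \<in> {1..m} \<Longrightarrow> k \<noteq> j \<Longrightarrow> C \<subseteq> V n \<Longrightarrow> cell_ends e' = f k ` C \<Longrightarrow> Q"
    for e' Q
  proof -
    obtain k v where kv: "e' = (k # v, F0)" "k \<in> {1..m}" "v \<in> words m n"
      using e' unfolding E by (auto elim!: words_SucE)
    have vE: "(v, F0) \<in> E n"
      using kv by (simp add: E)
    have ends: "cell_ends e' = f k ` cell_ends (v, F0)"
      using kv by (simp add: cell_ends_def image_comp[symmetric])
    show Q
    proof (cases "k = j")
      case True
      then have "(v, F0) \<noteq> (w, F0)"
        using e' kv jw by auto
      then show ?thesis
        using same_cell S(3)[OF vE] kv vE ends cell_ends_subset[OF vE] True by blast
    next
      case False
      then show ?thesis
        using other_cell kv ends cell_ends_subset[OF vE] by blast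
    qed
  qed
  show "\<exists>S. (x \<in> S) \<noteq> (y \<in> S) \<and> (\<forall>e'\<in>E (Suc n) - {e}. cell_ends e' \<subseteq> S \<or> cell_ends e' \<inter> S = {})"
  proof (cases "p \<in> S \<longleftrightarrow> q \<in> S")
    case True
    \<comment> \<open>Passing to the complement if necessary keeps \<open>p\<close> and
      \<open>q\<close> outside. Other cells meet cell \<open>j\<close> only in the images of these
      two points, so they miss the image of \<open>S2\<close> under \<open>f j\<close>.\<close>
    define S2 where "S2 = (if p \<in> S then V n - S else V n \<inter> S)"
    have S2: "S2 \<subseteq> V n" "p \<notin> S2" "q \<notin> S2" "(a \<in> S2) \<noteq> (b \<in> S2)"
      using True S ab by (auto simp: S2_def)
    have cut: "cell_ends e' \<subseteq> f j ` S2 \<or> cell_ends e' \<inter> f j ` S2 = {}" if e': "e' \<in> E (Suc n) - {e}" for e'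
    proof (rule other[OF e'])
      fix v
      assume v: "cell_ends e' = f j ` cell_ends (v, F0)" "cell_ends (v, F0) \<subseteq> V n"
        "cell_ends (v, F0) \<subseteq> S \<or> cell_ends (v, F0) \<inter> S = {}"
      then have "cell_ends (v, F0) \<subseteq> S2 \<or> cell_ends (v, F0) \<inter> S2 = {}"
        by (auto simp: S2_def)
      then show ?thesis
        unfolding v(1) by (rule inj_image_cut[OF inj_f[OF jw(2)]])
    next
      fix k C
      assume k: "k \<in> {1..m}" "k \<noteq> j" "C \<subseteq> V n" "cell_ends e' = f k ` C"
      have "f k c \<noteq> f j d" if "c \<in> C" "d \<in> S2" for c d
        using overlap(2)[OF k(1) jw(2) k(2), of c d] that k(3) S2 by blast
      then show ?thesis
        unfolding k(4) by blast
    qed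
    have "f j c \<in> f j ` S2 \<longleftrightarrow> c \<in> S2" for c
      using inj_f[OF jw(2)] by (rule inj_image_mem_iff)
    then have sep: "(x \<in> f j ` S2) \<noteq> (y \<in> f j ` S2)"
      using xy S2(4) by metis
    show ?thesis
      by (rule exI, rule conjI[OF sep], rule ballI, rule cut)
  next
    case False
    \<comment> \<open>Orienting the cut to contain \<open>p\<close> but not \<open>q\<close> matches
      it with the cut \<open>S1\<close> of \<open>V 1\<close> at \<open>f j p\<close> and
      \<open>f j q\<close>.\<close>
    define R where "R = (if p \<in> S then S else - S)"
    have R: "p \<in> R" "q \<notin> R" "(a \<in> R) \<noteq> (b \<in> R)"
      using False S by (auto simp: R_def)
    have jE: "([k], F0) \<in> E 1" if "k \<in> {1..m}" for k
      using that by (auto simp: E words_def)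
    have ends1: "cell_ends ([k], F0) = {f k p, f k q}" for k
      by (simp add: cell_ends_def F0)
    obtain S1 where S1: "f j p \<in> S1" "f j q \<notin> S1"
      "\<And>e'. e' \<in> E 1 \<Longrightarrow> e' \<noteq> ([j], F0) \<Longrightarrow> cell_ends e' \<subseteq> S1 \<or> cell_ends e' \<inter> S1 = {}"
      using forest_cutD[OF F1 jE[OF jw(2)] ends1] card_cell_ends by metis
    \<comment> \<open>No edge \<open>[k]\<close> with \<open>k\<close> different from
      \<open>j\<close> crosses \<open>S1\<close>, so \<open>f k p\<close> tells on which side both
      boundary points of cell \<open>k\<close> lie.\<close>
    have same: "f k c \<in> S1 \<longleftrightarrow> f k p \<in> S1" if "k \<in> {1..m}" "k \<noteq> j" "c \<in> {p, q}" for k c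
      using S1(3)[OF jE[OF that(1)]] that ends1 by auto
    \<comment> \<open>The glued cut splits cell \<open>j\<close> by \<open>R\<close> and takes every
      other cell entirely or not at all, as \<open>S1\<close> dictates.\<close>
    define S' where "S' = f j ` (R \<inter> V n) \<union> (\<Union>k\<in>{k\<in>{1..m} - {j}. f k p \<in> S1}. f k ` V n)"
    \<comment> \<open>A vertex of cell \<open>j\<close> that enters \<open>S'\<close> through
      another cell is \<open>f j p\<close> or \<open>f j q\<close>, and there \<open>R\<close> and
      \<open>S1\<close> agree.\<close>
    have in_j: "f j c \<in> S' \<longleftrightarrow> c \<in> R" if c: "c \<in> V n" for c
    proof
      assume "f j c \<in> S'"
      then have "f j c \<in> f j ` (R \<inter> V n) \<or>
          (\<exists>k d. k \<in> {1..m} \<and> k \<noteq> j \<and> f k p \<in> S1 \<and> d \<in> V n \<and> f j c = f k d)"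
        unfolding S'_def by blast
      then consider "c \<in> R" | k d where "k \<in> {1..m}" "k \<noteq> j" "f k p \<in> S1" "d \<in> V n" "f j c = f k d"
        unfolding inj_image_mem_iff[OF inj_f[OF jw(2)]] by blast
      then show "c \<in> R"
      proof cases
        case 2
        have "c \<in> {p, q}" "d \<in> {p, q}"
          using overlap[OF jw(2) 2(1) 2(2)[symmetric] c 2(4,5)] by blast+
        then have "f j c \<in> S1"
          using same[OF 2(1,2)] 2 by metis
        then show ?thesis
          using \<open>c \<in> {p, q}\<close> S1(2) R(1) by blast
      qed
    qed (use c in \<open>auto simp: S'_def\<close>)
    have in_k: "f k c \<in> S' \<longleftrightarrow> f k p \<in> S1" if k: "k \<in> {1..m}" "k \<noteq> j" and c: "c \<in> V n" for k c
    proof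
      assume "f k c \<in> S'"
      then consider d where "d \<in> R" "d \<in> V n" "f k c = f j d"
        | l d where "l \<in> {1..m}" "l \<noteq> j" "f l p \<in> S1" "d \<in> V n" "f k c = f l d"
        unfolding S'_def by blast
      then show "f k p \<in> S1"
      proof cases
        case 1
        have "c \<in> {p, q}" "d \<in> {p, q}"
          using overlap[OF k(1) jw(2) k(2) c 1(2,3)] by blast+
        then have "d = p"
          using 1 R by blast
        then have "f k c \<in> S1"
          using 1 S1 by simp
        then show ?thesis
          using same[OF k \<open>c \<in> {p, q}\<close>] by blast
      next
        case 2
        show ?thesis
        proof (cases "l = k")
          case False
          have "c \<in> {p, q}" "d \<in> {p, q}"
            using overlap[OF k(1) 2(1) False[symmetric] c 2(4,5)] by blast+
          then show ?thesis
            using same[OF 2(1,2)] same[OF k] 2 by metis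
        qed (use 2 in simp)
      qed
    qed (use k c in \<open>auto simp: S'_def\<close>)
    have cut: "cell_ends e' \<subseteq> S' \<or> cell_ends e' \<inter> S' = {}" if e': "e' \<in> E (Suc n) - {e}" for e'
    proof (rule other[OF e'])
      fix v
      assume v: "cell_ends e' = f j ` cell_ends (v, F0)" "cell_ends (v, F0) \<subseteq> V n"
        "cell_ends (v, F0) \<subseteq> S \<or> cell_ends (v, F0) \<inter> S = {}"
      then have "cell_ends (v, F0) \<subseteq> R \<or> cell_ends (v, F0) \<inter> R = {}"
        by (auto simp: R_def)
      then show ?thesis
        using v(2) in_j unfolding v(1) by blast
    next
      fix k C
      assume "k \<in> {1..m}" "k \<noteq> j" "C \<subseteq> V n" "cell_ends e' = f k ` C"
      then show ?thesis
        using in_k by (cases "f k p \<in> S1") auto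
    qed
    have sep: "(x \<in> S') \<noteq> (y \<in> S')"
      using xy R(3) in_j[OF ab(2)] in_j[OF ab(3)] by auto
    show ?thesis
      by (rule exI, rule conjI[OF sep], rule ballI, rule cut)
  qed
qed

lemma forest_all:
  assumes "forest cell_ends (E 1)"
  shows "forest cell_ends (E n)"
proof (induction n)
  case 0
  have "E 0 = {([], F0)}"
    using card_F0_if_forest[OF assms] card_subset_eq[OF finite_F0] by (auto simp: E_def)
  show ?case
  proof (rule forest_cutI)
    fix e x y assume "e \<in> E 0" "cell_ends e = {x, y}"
    then have "x \<noteq> y"
      using card_cell_ends by fastforce
    then show "\<exists>S. (x \<in> S) \<noteq> (y \<in> S) \<and> (\<forall>e'\<in>E 0 - {e}. cell_ends e' \<subseteq> S \<or> cell_ends e' \<inter> S = {})"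
      using \<open>e \<in> E 0\<close> \<open>E 0 = _\<close> by (intro exI[of _ "{x}"]) auto
  qed
qed (use forest_Suc assms in blast)

section \<open>The case of a graph with a cycle\<close>

text \<open>For an edge \<open>e\<close> that is not a bridge, one tree is grown from
  \<open>e\<close> and the other is found after deleting \<open>e\<close>.\<close>

lemma two_spanning_trees:
  assumes "\<not> forest cell_ends (E n)"
  obtains T0 T1 where "T0 \<noteq> T1" "T0 \<in> spanning_trees (approx_graph m f F0 n)"
    "T1 \<in> spanning_trees (approx_graph m f F0 n)"
proof -
  obtain e x y where e: "e \<in> E n" "cell_ends e = {x, y}"
    and xy: "(x, y) \<in> edge_conn cell_ends (E n - {e})"
    using assms by (auto simp: forest_def)
  have empty: "forest cell_ends {}" "edge_conn cell_ends {} = Id"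
    by (auto simp: forest_def edge_conn_def)
  have "x \<noteq> y"
    using card_cell_ends[OF e(1)] e(2) by auto
  then have "forest cell_ends {e}"
    using forest_insert[of cell_ends "{}" e x y] e empty by simp
  then obtain T1 where T1: "{e} \<subseteq> T1" "T1 \<in> spanning_trees (approx_graph m f F0 n)"
    using forest_extends_to_spanning_tree[of "{e}" "E n" n thesis] e(1) V_edge_conn[of _ n] by simp
  have "(u, v) \<in> edge_conn cell_ends (E n - {e})" if "u \<in> V n" "v \<in> V n" for u v
  proof -
    \<comment> \<open>Each use of \<open>e\<close> is replaced by the path around it.\<close>
    have "(id u, id v) \<in> edge_conn cell_ends (E n - {e})"
    proof (rule edge_conn_map[OF V_edge_conn[OF that]])
      fix e' a b assume e': "e' \<in> E n" "cell_ends e' = {a, b}"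
      show "(id a, id b) \<in> edge_conn cell_ends (E n - {e})"
      proof (cases "e' = e")
        case True
        then have "a = x \<and> b = y \<or> a = y \<and> b = x"
          using e e' by (auto simp: doubleton_eq_iff)
        then show ?thesis
          using xy edge_conn_sym by auto
      next
        case False
        then show ?thesis
          using e' by (auto intro: edge_conn_edge)
      qed
    qed
    then show ?thesis
      by simp
  qed
  then obtain T0 where "T0 \<subseteq> E n - {e}" "T0 \<in> spanning_trees (approx_graph m f F0 n)"
    using forest_extends_to_spanning_tree[of "{}" "E n - {e}" n thesis] empty(1) by blast
  with T1 show ?thesis
    by (intro that[of T0 T1]) auto
qed

lemma finite_spanning_trees: "finite (spanning_trees (approx_graph m f F0 n))"
  and num_spanning_trees_le: "num_spanning_trees (approx_graph m f F0 n) \<le> 2 ^ card (E n)"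
proof -
  have "spanning_trees (approx_graph m f F0 n) \<subseteq> Pow (E n)"
    by (auto simp: spanning_trees_approx_iff)
  moreover have "finite (Pow (E n))"
    using finite_E by simp
  ultimately show "finite (spanning_trees (approx_graph m f F0 n))"
    "num_spanning_trees (approx_graph m f F0 n) \<le> 2 ^ card (E n)"
    unfolding num_spanning_trees_def using finite_subset card_mono card_Pow[OF finite_E] by metis+
qed

text \<open>The copies of \<open>V 1\<close> in the cells of the words \<open>w @ u\<close>, with \<open>w\<close> of length \<open>n\<close>, are pairwise
  disjoint when the cell of \<open>u\<close> misses \<open>F0\<close>.  Hence spanning trees can be chosen independently in
  them, and a spanning tree of the whole graph extending these choices determines them.\<close>

lemma num_spanning_trees_ge:
  assumes "\<not> forest cell_ends (E 1)"
  shows "2 ^ (m ^ n) \<le> num_spanning_trees (approx_graph m f F0 (n + 3))"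
proof -
  obtain u where u: "u \<in> words m 2" "\<And>x. x \<in> K \<Longrightarrow> word_map f u x \<notin> F0"
    using exists_interior_word by blast
  obtain T0 T1 where T01: "T0 \<noteq> T1" "T0 \<in> spanning_trees (approx_graph m f F0 1)"
    "T1 \<in> spanning_trees (approx_graph m f F0 1)"
    using two_spanning_trees[OF assms] by blast
  \<comment> \<open>An element of \<open>P\<close> selects one of the two trees for each word of
    length \<open>n\<close>; \<open>A c\<close> collects the selected copies in the cells of the
    words \<open>w @ u\<close>.\<close>
  define P where "P = PiE (words m n) (\<lambda>_. {T0, T1})"
  define A where "A c = (\<Union>w\<in>words m n. shift (w @ u) ` c w)" for c
  have c: "c w \<subseteq> E 1" "\<And>x y. x \<in> V 1 \<Longrightarrow> y \<in> V 1 \<Longrightarrow> (x, y) \<in> edge_conn cell_ends (c w)"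
    "forest cell_ends (c w)" if "c \<in> P" "w \<in> words m n" for c w
  proof -
    have "c w \<in> {T0, T1}"
      using that by (auto simp: P_def)
    then have "c w \<in> spanning_trees (approx_graph m f F0 1)"
      using T01 by blast
    then show "c w \<subseteq> E 1" "\<And>x y. x \<in> V 1 \<Longrightarrow> y \<in> V 1 \<Longrightarrow> (x, y) \<in> edge_conn cell_ends (c w)"
      "forest cell_ends (c w)"
      by (auto simp: spanning_trees_approx_iff)
  qed
  have wu: "w @ u \<in> words m (n + 2)" if "w \<in> words m n" for w
    using append_in_words[OF that u(1)] .
  have A_sub: "A c \<subseteq> E (n + 3)" if cP: "c \<in> P" for c
  proof
    fix e assume "e \<in> A c"
    then obtain w e0 where w: "w \<in> words m n" "e0 \<in> c w" "e = shift (w @ u) e0"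
      unfolding A_def by blast
    \<comment> \<open>The level counts \<open>n\<close> letters of \<open>w\<close>, two letters of
      \<open>u\<close>, and one for the edges of \<open>V 1\<close>.\<close>
    have "n + 2 + 1 = n + 3"
      by simp
    then show "e \<in> E (n + 3)"
      using shift_in_E[OF wu[OF w(1)], of e0 1] c(1)[OF cP w(1)] w by (metis subsetD)
  qed
  \<comment> \<open>By \<open>word_map_overlap\<close> a common point would put
    \<open>word_map f u s\<close> into \<open>F0\<close>, against the choice of
    \<open>u\<close>.\<close>
  have disj: "word_map f (w @ u) s \<noteq> word_map f (w' @ u) t"
    if "w \<in> words m n" "w' \<in> words m n" "w \<noteq> w'" "s \<in> V 1" "t \<in> V 1" for w w' s t
  proof
    assume eq: "word_map f (w @ u) s = word_map f (w' @ u) t"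
    have "s \<in> K" "t \<in> K"
      using that V_subset_K by auto
    then show False
      using word_map_overlap[OF that(1-3), of "word_map f u s" "word_map f u t"] eq u word_map_in_K
      by auto
  qed
  have A_forest: "forest cell_ends (A c)" if cP: "c \<in> P" for c
  proof (rule forest_cutI)
    fix e x y assume e: "e \<in> A c" "cell_ends e = {x, y}"
    then obtain w e0 where w: "w \<in> words m n" "e0 \<in> c w" "e = shift (w @ u) e0"
      by (auto simp: A_def)
    have e0: "e0 \<in> E 1"
      using c(1)[OF cP w(1)] w by blast
    define g where "g = word_map f (w @ u)"
    have g: "inj g"
      unfolding g_def using inj_word_map[OF wu[OF w(1)]] .
    obtain a b where ab: "cell_ends e0 = {a, b}"
      using card_cell_ends[OF e0] by (auto simp: card_2_iff)
    have abV: "a \<in> V 1" "b \<in> V 1"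
      using cell_ends_subset[OF e0] ab by auto
    have "{x, y} = {g a, g b}"
      using e(2) unfolding w(3) cell_ends_shift ab g_def by simp
    then have xy: "x = g a \<and> y = g b \<or> x = g b \<and> y = g a"
      by (auto simp: doubleton_eq_iff)
    obtain S where S: "a \<in> S" "b \<notin> S"
      "\<And>e'. e' \<in> c w \<Longrightarrow> e' \<noteq> e0 \<Longrightarrow> cell_ends e' \<subseteq> S \<or> cell_ends e' \<inter> S = {}"
      using forest_cutD[OF c(3)[OF cP w(1)] w(2) ab] card_cell_ends c(1)[OF cP w(1)]
      by (metis subsetD)
    \<comment> \<open>The cut is restricted to \<open>V 1\<close> because \<open>disj\<close>
      separates the copies only at vertices.\<close>
    let ?S = "g ` (S \<inter> V 1)"
    have cut: "cell_ends e' \<subseteq> ?S \<or> cell_ends e' \<inter> ?S = {}" if e': "e' \<in> A c - {e}" for e'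
    proof -
      obtain w' e1 where w': "w' \<in> words m n" "e1 \<in> c w'" "e' = shift (w' @ u) e1"
        using e' by (auto simp: A_def)
      have e1: "cell_ends e1 \<subseteq> V 1"
        using c(1)[OF cP w'(1)] w'(2) cell_ends_subset by blast
      have ends: "cell_ends e' = word_map f (w' @ u) ` cell_ends e1"
        unfolding w'(3) by (rule cell_ends_shift)
      show ?thesis
      proof (cases "w' = w")
        case True
        then have "e1 \<noteq> e0" "e1 \<in> c w"
          using w w' e' by auto
        from S(3)[OF this(2,1)] have "cell_ends e1 \<subseteq> S \<inter> V 1 \<or> cell_ends e1 \<inter> (S \<inter> V 1) = {}"
          using e1 by blast
        then show ?thesis
          unfolding ends True g_def[symmetric] by (rule inj_image_cut[OF g])
      next
        case False
        then show ?thesis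
          unfolding ends g_def using disj[OF w'(1) w(1) False] e1
          by (intro disjI2) (fastforce simp del: word_map_simps)
      qed
    qed
    have "g a \<in> ?S" "g b \<notin> ?S"
      using S abV by (auto simp: inj_image_mem_iff[OF g])
    then have sep: "(x \<in> ?S) \<noteq> (y \<in> ?S)"
      using xy by metis
    show "\<exists>S. (x \<in> S) \<noteq> (y \<in> S) \<and>
        (\<forall>e'\<in>A c - {e}. cell_ends e' \<subseteq> S \<or> cell_ends e' \<inter> S = {})"
      by (rule exI, rule conjI[OF sep], rule ballI, rule cut)
  qed
  have "\<forall>c\<in>P. \<exists>T. A c \<subseteq> T \<and> T \<in> spanning_trees (approx_graph m f F0 (n + 3))"
  proof
    fix c assume c: "c \<in> P"
    show "\<exists>T. A c \<subseteq> T \<and> T \<in> spanning_trees (approx_graph m f F0 (n + 3))"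
      by (rule forest_extends_to_spanning_tree[OF A_forest[OF c] A_sub[OF c] order_refl V_edge_conn])
        (assumption | blast)+
  qed
  then obtain T where T: "\<And>c. c \<in> P \<Longrightarrow> A c \<subseteq> T c"
    "\<And>c. c \<in> P \<Longrightarrow> T c \<in> spanning_trees (approx_graph m f F0 (n + 3))"
    by metis
  \<comment> \<open>The edges of \<open>c w\<close> already connect their copy of
    \<open>V 1\<close>, so any further edge of this copy in \<open>T c\<close> would not be a
    bridge. Hence \<open>T c\<close> determines \<open>c\<close>.\<close>
  have recover: "c w = {e \<in> E 1. shift (w @ u) e \<in> T c}" if cP: "c \<in> P" and w: "w \<in> words m n" for c w
  proof (intro equalityI subsetI)
    fix e assume "e \<in> c w"
    then have "shift (w @ u) e \<in> A c"
      using w by (auto simp: A_def)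
    then show "e \<in> {e \<in> E 1. shift (w @ u) e \<in> T c}"
      using T(1)[OF cP] c(1)[OF cP w] \<open>e \<in> c w\<close> by blast
  next
    fix e assume "e \<in> {e \<in> E 1. shift (w @ u) e \<in> T c}"
    then have e: "e \<in> E 1" "shift (w @ u) e \<in> T c"
      by auto
    show "e \<in> c w"
    proof (rule ccontr)
      assume ne: "e \<notin> c w"
      obtain a b where ab: "cell_ends e = {a, b}"
        using card_cell_ends[OF e(1)] by (auto simp: card_2_iff)
      then have "(a, b) \<in> edge_conn cell_ends (c w)"
        using c(2)[OF cP w] cell_ends_subset[OF e(1)] by auto
      then have "(word_map f (w @ u) a, word_map f (w @ u) b)
          \<in> edge_conn cell_ends (shift (w @ u) ` c w)"
        by (rule edge_conn_shift)
      moreover have "shift (w @ u) ` c w \<subseteq> T c - {shift (w @ u) e}"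
        using T(1)[OF cP] ne w injD[OF inj_shift] unfolding A_def by blast
      ultimately have "(word_map f (w @ u) a, word_map f (w @ u) b)
          \<in> edge_conn cell_ends (T c - {shift (w @ u) e})"
        by (rule edge_conn_mono)
      moreover have "cell_ends (shift (w @ u) e) = {word_map f (w @ u) a, word_map f (w @ u) b}"
        unfolding cell_ends_shift ab by simp
      moreover have "forest cell_ends (T c)"
        using T(2)[OF cP] unfolding spanning_trees_approx_iff by blast
      ultimately show False
        using e(2) unfolding forest_def by blast
    qed
  qed
  have "inj_on T P"
  proof (rule inj_onI)
    fix c c' assume cc: "c \<in> P" "c' \<in> P" "T c = T c'"
    show "c = c'"
      using cc(1,2) recover[OF cc(1)] recover[OF cc(2)] cc(3) unfolding P_def
      by (intro PiE_ext[of c _ _ c']) auto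
  qed
  then have "card P \<le> num_spanning_trees (approx_graph m f F0 (n + 3))"
    unfolding num_spanning_trees_def
    using T(2) finite_spanning_trees by (intro card_inj_on_le[of T]) auto
  moreover have "card P = 2 ^ (m ^ n)"
    using T01(1) by (simp add: P_def card_PiE finite_words card_words numeral_2_eq_2)
  ultimately show ?thesis
    by simp
qed

section \<open>Growth of the number of vertices\<close>

lemma card_V_le: "card (V n) \<le> m ^ n * card F0"
proof -
  have "card (V n) \<le> (\<Sum>w\<in>words m n. card (word_map f w ` F0))"
    unfolding V_def using finite_words by (rule card_UN_le)
  also have "\<dots> \<le> (\<Sum>w\<in>words m n. card F0)"
    by (intro sum_mono card_image_le finite_F0)
  finally show ?thesis
    by (simp add: card_words)
qed

text \<open>One fixed point of \<open>F0\<close> is placed in the cell of each \<open>w @ u\<close>.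
  Different \<open>w\<close> give different vertices, since a coincidence would put a point of the
  cell of \<open>u\<close> into \<open>F0\<close>.\<close>

lemma card_V_ge: "m ^ n \<le> card (V (n + 2))"
proof -
  obtain u where u: "u \<in> words m 2" "\<And>x. x \<in> K \<Longrightarrow> word_map f u x \<notin> F0"
    using exists_interior_word by blast
  obtain v where v: "v \<in> F0" "v \<in> K"
    using F0_not_empty F0_subset by blast
  have "inj_on (\<lambda>w. word_map f (w @ u) v) (words m n)"
  proof (rule inj_onI, rule ccontr)
    fix w w'
    assume "w \<in> words m n" "w' \<in> words m n" "word_map f (w @ u) v = word_map f (w' @ u) v" "w \<noteq> w'"
    then show False
      using word_map_overlap[of w n w' "word_map f u v" "word_map f u v"] u v word_map_in_K by auto
  qed
  moreover have "(\<lambda>w. word_map f (w @ u) v) ` words m n \<subseteq> V (n + 2)"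
    using append_in_words[OF _ u(1)] v unfolding V_def by blast
  moreover have "finite (V (n + 2))"
    using finite_words finite_F0 by (simp add: V_def)
  ultimately show ?thesis
    using card_inj_on_le card_words by metis
qed

end

section \<open>Passage to asymptotic form and conclusion\<close>

text \<open>A lower bound that is delayed by \<open>k\<close> levels costs only the constant factor
  \<open>M ^ k\<close>.\<close>

lemma bigtheta_powerI:
  fixes g :: "nat \<Rightarrow> real"
  assumes "M > 0" "c > 0" "\<And>n. c * M ^ n \<le> g (n + k)" "\<And>n. g n \<le> C * M ^ n"
  shows "g \<in> \<Theta>(\<lambda>n. M ^ n)"
proof (rule bigthetaI')
  \<comment> \<open>Adding 1 to the absolute value gives a positive upper constant whatever the sign
    of \<open>C\<close>.\<close>
  show "c / M ^ k > 0" "\<bar>C\<bar> + 1 > 0"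
    using assms by auto
  have "c / M ^ k * norm (M ^ n) \<le> norm (g n) \<and> norm (g n) \<le> (\<bar>C\<bar> + 1) * norm (M ^ n)" if "n \<ge> k" for n
  proof -
    have lower: "c / M ^ k * M ^ n \<le> g n"
      using assms(1) assms(3)[of "n - k"] that by (simp add: power_diff field_simps)
    moreover have "0 \<le> c / M ^ k * M ^ n"
      using assms(1,2) by simp
    moreover have "g n \<le> (\<bar>C\<bar> + 1) * M ^ n"
      using assms(4)[of n] mult_right_mono[of C "\<bar>C\<bar> + 1" "M ^ n"] assms(1)
      by (meson abs_ge_self add_increasing2 order_trans zero_le_one zero_le_power less_imp_le)
    ultimately show ?thesis
      using assms(1) by simp
  qed
  then show "\<forall>\<^sub>F n in sequentially.
      c / M ^ k * norm (M ^ n) \<le> norm (g n) \<and> norm (g n) \<le> (\<bar>C\<bar> + 1) * norm (M ^ n)"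
    unfolding eventually_sequentially by blast
qed

theorem theorem4p1:
  fixes m :: nat and f :: "nat \<Rightarrow> 'a::complete_space \<Rightarrow> 'a" and K F0 :: "'a set"
  assumes "finitely_ramified m f K F0"
  shows
    "(mtree (approx_graph m f F0 1) \<longrightarrow>
        (\<forall>n. num_spanning_trees (approx_graph m f F0 n) = 1)) \<and>
     (\<not> mtree (approx_graph m f F0 1) \<longrightarrow>
        (\<lambda>n. ln (real (num_spanning_trees (approx_graph m f F0 n))))
          \<in> \<Theta>(\<lambda>n. real (card (mverts (approx_graph m f F0 n)))) \<and>
        \<Theta>(\<lambda>n. real (card (mverts (approx_graph m f F0 n)))) = \<Theta>(\<lambda>n. real m ^ n))"
proof -
  interpret finitely_ramified m f K F0
    by fact
  have tree: "num_spanning_trees (approx_graph m f F0 n) = 1" if "mtree (approx_graph m f F0 1)" for n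
    using that spanning_trees_eq_if_forest[OF forest_all]
    by (simp add: mtree_approx_iff num_spanning_trees_def)
  let ?v = "\<lambda>n. real (card (mverts (approx_graph m f F0 n)))"
    and ?t = "\<lambda>n. ln (real (num_spanning_trees (approx_graph m f F0 n)))"
  have "?v \<in> \<Theta>(\<lambda>n. real m ^ n)"
  \<comment> \<open>The delay 2 is the length of the interior word in \<open>card_V_ge\<close>; the
    upper constant allows one copy of \<open>F0\<close> per word.\<close>
  proof (rule bigtheta_powerI[of _ 1 _ 2 "real (card F0)"])
    show "1 * real m ^ n \<le> ?v (n + 2)" for n
      using card_V_ge[of n] by (simp flip: of_nat_power)
    have "real (card (V n)) \<le> real (m ^ n * card F0)" for n
      using card_V_le[of n] by (simp only: of_nat_le_iff)
    then show "?v n \<le> real (card F0) * real m ^ n" for n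
      by (simp add: mult.commute)
  qed (use m_pos in auto)
  then have V: "\<Theta>(?v) = \<Theta>(\<lambda>n. real m ^ n)"
    by (rule landau_theta.cong_bigtheta)
  have "?t \<in> \<Theta>(\<lambda>n. real m ^ n)" if "\<not> mtree (approx_graph m f F0 1)"
  \<comment> \<open>The lower bound has one binary choice per word of length \<open>n\<close>, three
    levels up; the upper bound counts all subsets of the edges.\<close>
  proof (rule bigtheta_powerI[of _ "ln 2" _ 3 "real (card {e. e \<subseteq> F0 \<and> card e = 2}) * ln 2"])
    have ge: "2 ^ (m ^ n) \<le> num_spanning_trees (approx_graph m f F0 (n + 3))" for n
      using num_spanning_trees_ge that by (simp add: mtree_approx_iff)
    show "ln 2 * real m ^ n \<le> ?t (n + 3)" for n
    proof -
      have "ln (2 ^ (m ^ n)) \<le> ?t (n + 3)"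
        using of_nat_mono[OF ge[of n], where 'a = real] by (intro ln_mono) auto
      then show ?thesis
        by (simp add: ln_realpow mult.commute)
    qed
    show "?t n \<le> real (card {e. e \<subseteq> F0 \<and> card e = 2}) * ln 2 * real m ^ n" for n
    \<comment> \<open>The case 0 is settled by the convention \<open>ln 0 = 0\<close>, since the
      right side is nonnegative.\<close>
    proof (cases "num_spanning_trees (approx_graph m f F0 n) = 0")
      case False
      then have "?t n \<le> ln (2 ^ card (E n))"
        using of_nat_mono[OF num_spanning_trees_le[of n], where 'a = real] by (intro ln_mono) auto
      then show ?thesis
        by (simp add: ln_realpow E_def card_cartesian_product card_words mult_ac)
    qed simp
  qed (use m_pos in auto)
  then show ?thesis
    using tree V by auto
qed

end
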